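(* Let $d>1$, let $\mathbf x_1,\dots,\mathbf x_n\in\mathbb{R}^d$ be distinct design points, and for $\mathbf y\in\mathbb{R}^n$ let $(\hat{\boldsymbol\theta}(\mathbf y),\hat{\boldsymbol\xi}(\mathbf y))$, with $\hat{\boldsymbol\xi}=[\hat{\boldsymbol\xi}_1^\top,\dots,\hat{\boldsymbol\xi}_n^\top]^\top$, be a solution of the multivariate convex least squares problem $$\min_{\boldsymbol\theta\in\mathbb{R}^n,\ \boldsymbol\xi=[\boldsymbol\xi_1^\top,\dots,\boldsymbol\xi_n^\top]^\top\in\mathbb{R}^{nd}}\ \tfrac12\|\boldsymbol\theta-\mathbf y\|_2^2\quad\text{s.t.}\quad\langle\boldsymbol\xi_j,\mathbf x_k-\mathbf x_j\rangle\le\theta_k-\theta_j\quad\forall\, j\ne k\in\{1,\dots,n\}.$$ Let $J_{\mathbf y}:=\{(j,k): j\neq k,\ \langle\hat{\boldsymbol\xi}_j,\mathbf x_k-\mathbf x_j\rangle=\hat\theta_k-\hat\theta_j\}$ and let $I_{\mathbf y}\subseteq J_{\mathbf y}$ be the index set of a maximal set of linearly independent rows of $[A_{J_{\mathbf y}},B_{J_{\mathbf y}}]$, where $A$ and $B$ are the matrices defined in the context. Then for almost every $\mathbf y\in\mathbb{R}^n$, $$D(\mathbf y)=n-|I_{\mathbf y}|+\mathrm{rank}(A_{I_{\mathbf y}}),$$ and $\mathrm{df}(\hat{\boldsymbol\theta}(\mathbf y))=n-\mathbb{E}[|I_{\mathbf y}|]+\mathbb{E}[\mathrm{rank}(A_{I_{\mathbf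 y}})]$.
   Context: $A$ is the $[n(n-1)]\times nd$ matrix whose rows are indexed by ordered pairs $r=(j,k)$, $j\ne k\in\{1,\dots,n\}$, and whose columns are partitioned into $n$ blocks of width $d$: the block of row $(j,k)$ and column block $j'\in\{1,\dots,n\}$ is $\mathbf x_k^\top-\mathbf x_j^\top$ if $j'=j$, and $\mathbf 0^\top$ otherwise. $B$ is the $[n(n-1)]\times n$ matrix with rows indexed in the same way, whose entry in row $(j,k)$ and column $c$ is $1$ if $c=j$, $-1$ if $c=k$, and $0$ otherwise. (Thus the constraints read $A\boldsymbol\xi+B\boldsymbol\theta\le\mathbf 0$.) For a set $J$ of row indices, $A_J,B_J$ are the submatrices with rows in $J$. The divergence is $D(\mathbf y):=\sum_{i=1}^n\frac{\partial}{\partial y_i}\hat\theta_i(\mathbf y)$ (the component $\hat{\boldsymbol\theta}(\mathbf y)$ is unique). For the degrees of freedom, $\mathbf y=\boldsymbol\theta^*+\boldsymbol\epsilon$ with $\boldsymbol\theta^*\in\mathbb{R}^n$ fixed, $\boldsymbol\epsilon\sim N(\mathbf 0,\sigma^2I_n)$, $\sigma>0$, and $\mathrm{df}(\hat{\boldsymbol\theta}(\mathbf y)):=\frac1{\sigma^2}\sum_{i=1}^n\mathrm{Cov}(\hat\theta_i(\mathbf y),y_i)$. *)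

theory Defs
  imports "HOL-Probability.Probability"
begin

text \<open>
  The index set \<open>{1..n}\<close> is the finite type \<open>'n\<close> and \<open>\<real>\<^sup>d\<close> is \<open>real ^ 'd\<close>; the stacked
  vector \<open>\<xi> \<in> \<real>\<^sup>n\<^sup>d\<close> is kept in blocks, \<open>\<xi> $ j\<close> being the \<open>j\<close>-th block.
\<close>

definition cls_feasible ::
  "('n::finite \<Rightarrow> real ^ 'd::finite) \<Rightarrow> real ^ 'n \<Rightarrow> (real ^ 'd) ^ 'n \<Rightarrow> bool" where
  "cls_feasible x \<theta> \<xi> \<longleftrightarrow> (\<forall>j k. j \<noteq> k \<longrightarrow> (\<xi> $ j) \<bullet> (x k - x j) \<le> \<theta> $ k - \<theta> $ j)"

definition cls_solution ::
  "('n::finite \<Rightarrow> real ^ 'd::finite) \<Rightarrow> real ^ 'n \<Rightarrow> real ^ 'n \<Rightarrow> (real ^ 'd) ^ 'n \<Rightarrow> bool" where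
  "cls_solution x y \<theta> \<xi> \<longleftrightarrow>
     is_arg_min (\<lambda>(\<theta>', \<xi>'). 1/2 * (norm (\<theta>' - y))\<^sup>2) (\<lambda>(\<theta>', \<xi>'). cls_feasible x \<theta>' \<xi>') (\<theta>, \<xi>)"

text \<open>
  Rows are indexed by all pairs \<open>(j, k)\<close>, since the pairs with \<open>j \<noteq> k\<close> do not form a type when
  \<open>n = 1\<close>. The diagonal rows are meaningless; only sets of rows with \<open>j \<noteq> k\<close> are ever selected.
\<close>

definition matA ::
  "('n::finite \<Rightarrow> real ^ 'd::finite) \<Rightarrow> real ^ ('n \<times> 'd) ^ ('n \<times> 'n)" where
  "matA x = (\<chi> r c. case r of (j, k) \<Rightarrow> case c of (j', l) \<Rightarrow>
               if j' = j then (x k - x j) $ l else 0)"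

definition matB :: "real ^ 'n ^ ('n::finite \<times> 'n)" where
  "matB = (\<chi> r c. case r of (j, k) \<Rightarrow> if c = j then 1 else if c = k then - 1 else 0)"

definition hconcat ::
  "real ^ 'a::finite ^ 'r::finite \<Rightarrow> real ^ 'b::finite ^ 'r \<Rightarrow> real ^ ('a + 'b) ^ 'r" where
  "hconcat P Q = (\<chi> r c. case c of Inl a \<Rightarrow> P $ r $ a | Inr b \<Rightarrow> Q $ r $ b)"

text \<open>
  The submatrix with rows in \<open>J\<close>. The row index type cannot depend on \<open>J\<close>, so the rows outside \<open>J\<close>
  are replaced by zero rows, which does not affect the rank.
\<close>

definition row_submatrix ::
  "('r::finite) set \<Rightarrow> real ^ 'c::finite ^ 'r \<Rightarrow> real ^ 'c ^ 'r" where
  "row_submatrix J P = (\<chi> r. if r \<in> J then row r P else 0)"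

text \<open>Linear independence of the rows as a family: the indexed rows must also be distinct.\<close>

definition independent_rows :: "real ^ 'c::finite ^ 'r::finite \<Rightarrow> 'r set \<Rightarrow> bool" where
  "independent_rows P K \<longleftrightarrow> inj_on (\<lambda>r. row r P) K \<and> independent ((\<lambda>r. row r P) ` K)"

definition maximal_independent_rows ::
  "real ^ 'c::finite ^ 'r::finite \<Rightarrow> 'r set \<Rightarrow> 'r set \<Rightarrow> bool" where
  "maximal_independent_rows P J I \<longleftrightarrow>
     I \<subseteq> J \<and> independent_rows P I \<and>
     (\<forall>K. I \<subseteq> K \<and> K \<subseteq> J \<and> independent_rows P K \<longrightarrow> K = I)"

definition active_set ::
  "('n::finite \<Rightarrow> real ^ 'd::finite) \<Rightarrow> real ^ 'n \<Rightarrow> (real ^ 'd) ^ 'n \<Rightarrow> ('n \<times> 'n) set" where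
  "active_set x \<theta> \<xi> = {(j, k). j \<noteq> k \<and> (\<xi> $ j) \<bullet> (x k - x j) = \<theta> $ k - \<theta> $ j}"

definition partial_diffs_exist :: "(real ^ 'n \<Rightarrow> real ^ 'n) \<Rightarrow> real ^ 'n::finite \<Rightarrow> bool" where
  "partial_diffs_exist f y \<longleftrightarrow>
     (\<forall>i. (\<lambda>t. f (y + t *\<^sub>R axis i 1) $ i) field_differentiable (at 0))"

definition divergence :: "(real ^ 'n \<Rightarrow> real ^ 'n) \<Rightarrow> real ^ 'n::finite \<Rightarrow> real" where
  "divergence f y = (\<Sum>i\<in>UNIV. deriv (\<lambda>t. f (y + t *\<^sub>R axis i 1) $ i) 0)"

text \<open>The joint density of \<open>N(0, \<sigma>\<^sup>2 I\<^sub>n)\<close>.\<close>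

definition iso_normal_density :: "real \<Rightarrow> real ^ 'n::finite \<Rightarrow> real" where
  "iso_normal_density \<sigma> e = (\<Prod>i\<in>UNIV. normal_density 0 \<sigma> (e $ i))"

definition covariance :: "'w measure \<Rightarrow> ('w \<Rightarrow> real) \<Rightarrow> ('w \<Rightarrow> real) \<Rightarrow> real" where
  "covariance M X Y =
     (\<integral>\<omega>. (X \<omega> - (\<integral>\<omega>'. X \<omega>' \<partial>M)) * (Y \<omega> - (\<integral>\<omega>'. Y \<omega>' \<partial>M)) \<partial>M)"

definition degrees_of_freedom ::
  "'w measure \<Rightarrow> real \<Rightarrow> (real ^ 'n \<Rightarrow> real ^ 'n) \<Rightarrow> ('w \<Rightarrow> real ^ 'n::finite) \<Rightarrow> real" where
  "degrees_of_freedom M \<sigma> f Y =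
     1 / \<sigma>\<^sup>2 * (\<Sum>i\<in>UNIV. covariance M (\<lambda>\<omega>. f (Y \<omega>) $ i) (\<lambda>\<omega>. Y \<omega> $ i))"

end

theory Submission
  imports Defs
begin

text \<open>
  The constraints cut out a polyhedral cone of pairs \<open>(\<theta>, \<xi>)\<close>, so \<open>\<theta>h y\<close> is the point nearest to \<open>y\<close>
  in the convex cone of all feasible \<open>\<theta>\<close>, and the variational inequality of such a point makes \<open>\<theta>h\<close>
  nonexpansive (\<open>cls_solution_nonexpansive\<close>).

  Let \<open>J\<close> be the active set of the chosen solution at \<open>y\<close>, and let \<open>V\<^sub>J\<close> (\<open>active_space\<close>) be the
  subspace of those \<open>\<theta>\<close> which, with a suitable \<open>\<xi>\<close>, satisfy every constraint in \<open>J\<close> with equality. A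
  small move from \<open>\<theta>h y\<close> along a direction of \<open>V\<^sub>J\<close>, forwards or backwards, stays feasible: constraints
  in \<open>J\<close> remain equalities and the others have slack. Optimality therefore forces \<open>y - \<theta>h y\<close> to be
  orthogonal to \<open>V\<^sub>J\<close>; since \<open>\<theta>h y\<close> itself lies in \<open>V\<^sub>J\<close>, it is the orthogonal projection of \<open>y\<close> onto
  \<open>V\<^sub>J\<close> (\<open>cls_solution_orthogonal_projection\<close>).

  Hence \<open>\<theta>h\<close> is a continuous map whose value at every point is the value of one of finitely many linear
  projections. Two different linear maps agree only on a null set; at a point where no two different
  ones agree, continuity prevents \<open>\<theta>h\<close> from switching to another projection nearby
  (\<open>AE_continuous_linear_selection\<close>). So for almost every \<open>y\<close> the map \<open>\<theta>h\<close> coincides with the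
  projection onto \<open>V\<^sub>J\<close> near \<open>y\<close>, and its divergence is the trace of that projection, that is
  \<open>dim V\<^sub>J\<close>. This also shows that the value does not depend on which \<open>\<xi>\<close> was selected, although
  \<open>J\<close> may.

  The dimension is a matter of rank and nullity: the solution space of \<open>A\<^sub>J \<xi> + B\<^sub>J \<theta> = 0\<close> has
  dimension \<open>nd + n - \<bar>I\<bar>\<close>, and \<open>V\<^sub>J\<close> is its image under \<open>(\<xi>, \<theta>) \<mapsto> \<theta>\<close>, whose kernel is
  the null space of \<open>A\<^sub>I\<close> and has dimension \<open>nd - rank A\<^sub>I\<close> (\<open>dim_projected_null_space\<close>).

  The degrees of freedom follow by Stein's identity for Lipschitz maps (\<open>stein_degrees_of_freedom\<close>).
  It is obtained without integration by parts. The expected difference quotient of a component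
  of \<open>\<theta>h\<close> in direction \<open>i\<close> has two limits: dominated convergence with the Lipschitz bound gives the
  expected partial derivative, while shifting the translation onto the Gaussian density gives the
  covariance divided by \<open>\<sigma>\<^sup>2\<close>.
\<close>

section \<open>Dimension of the projection of a null space\<close>

text \<open>
  Rank and nullity for a map restricted to a subspace: on the orthogonal complement of the kernel
  inside \<open>W\<close> the map is injective and has the same image.
\<close>

lemma dim_kernel_plus_dim_image:
  fixes f :: "'a::euclidean_space \<Rightarrow> 'b::euclidean_space"
  assumes f: "linear f" and W: "subspace W"
  shows "dim {x \<in> W. f x = 0} + dim (f ` W) = dim W"
proof -
  define K where "K = {x \<in> W. f x = 0}"
  define L where "L = {y \<in> W. \<forall>x\<in>K. orthogonal x y}"
  have K: "subspace K"
    using W f by (auto simp: K_def subspace_def linear_0 linear_add linear_scale)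
  have L: "subspace L"
    using W by (auto simp: L_def subspace_def orthogonal_def inner_add_right)
  have "dim L + dim K = dim W"
    unfolding L_def by (rule dim_subspace_orthogonal_to_vectors[OF K W]) (auto simp: K_def)
  moreover have "dim (f ` L) = dim L"
  proof (rule dim_image_eq[OF f])
    have "x = y" if "x \<in> L" "y \<in> L" "f x = f y" for x y
    proof -
      have "x - y \<in> L"
        using that L by (simp add: subspace_diff)
      moreover have "x - y \<in> K"
        using that W f by (simp add: K_def L_def linear_diff subspace_diff)
      ultimately have "orthogonal (x - y) (x - y)"
        by (simp add: L_def)
      then show ?thesis by (simp add: orthogonal_def)
    qed
    moreover have "span L = L"
      using L by (simp add: span_eq_iff)
    ultimately show "inj_on f (span L)"
      by (metis inj_onI)
  qed
  moreover have "f ` L = f ` W"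
  proof
    show "f ` W \<subseteq> f ` L"
    proof clarify
      fix w assume w: "w \<in> W"
      obtain k l where kl: "k \<in> span K" "\<And>v. v \<in> span K \<Longrightarrow> orthogonal l v" "w = k + l"
        using orthogonal_subspace_decomp_exists[of K w] by metis
      have "k \<in> K" using kl(1) K by (metis span_eq_iff)
      then have "l \<in> W" and "f w = f l"
        using w kl W subspace_diff[OF W w, of k] f by (auto simp: K_def linear_add)
      moreover have "\<forall>x\<in>K. orthogonal x l"
        using kl by (metis orthogonal_commute span_base)
      ultimately show "f w \<in> f ` L" by (auto simp: L_def)
    qed
  qed (auto simp: L_def)
  ultimately show ?thesis by (simp add: K_def)
qed

lemma maximal_independent_rows_span:
  assumes "maximal_independent_rows P J I" and "r \<in> J"
  shows "row r P \<in> span ((\<lambda>r. row r P) ` I)"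
proof (rule ccontr)
  assume *: "row r P \<notin> span ((\<lambda>r. row r P) ` I)"
  have I: "I \<subseteq> J" "independent_rows P I"
    and max: "\<And>K. I \<subseteq> K \<Longrightarrow> K \<subseteq> J \<Longrightarrow> independent_rows P K \<Longrightarrow> K = I"
    using assms by (auto simp: maximal_independent_rows_def)
  have notin: "row r P \<notin> (\<lambda>r. row r P) ` I"
    using * by (meson span_base)
  have "independent (insert (row r P) ((\<lambda>r. row r P) ` I))"
    using I(2) * by (simp add: independent_rows_def independent_insert)
  then have "independent_rows P (insert r I)"
    using I(2) notin by (simp add: independent_rows_def inj_on_insert) blast
  then have "insert r I = I"
    using max[of "insert r I"] I assms(2) by blast
  then show False using notin by blast
qed

definition stack :: "real ^ 'a::finite \<Rightarrow> real ^ 'b::finite \<Rightarrow> real ^ ('a + 'b)" where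
  "stack u v = (\<chi> c. case c of Inl a \<Rightarrow> u $ a | Inr b \<Rightarrow> v $ b)"

lemma inner_row_hconcat_stack:
  "row r (hconcat P Q) \<bullet> stack u v = row r P \<bullet> u + row r Q \<bullet> v"
  by (simp add: inner_vec_def row_def hconcat_def stack_def UNIV_Plus_UNIV[symmetric] sum.Plus
    del: UNIV_Plus_UNIV)

lemma stack_exhaust: obtains u v where "z = stack u v"
proof
  show "z = stack (\<chi> a. z $ Inl a) (\<chi> b. z $ Inr b)"
    by (simp add: stack_def vec_eq_iff split: sum.split)
qed

text \<open>
  By maximality the rows in \<open>J\<close> lie in the span of the rows in \<open>I\<close>, so \<open>J\<close> and \<open>I\<close> define the same
  null space \<open>W\<close> of \<open>[P, Q]\<close>, of codimension \<open>\<bar>I\<bar>\<close>. The set in question is the image of \<open>W\<close> under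
  dropping \<open>u\<close>; the kernel of this map consists of the \<open>u\<close> with \<open>P\<^sub>I u = 0\<close>.
  The cardinality is added on the left because the dimensions are natural numbers.
\<close>

lemma dim_projected_null_space:
  fixes P :: "real ^ 'a::finite ^ 'r::finite" and Q :: "real ^ 'b::finite ^ 'r"
  assumes max: "maximal_independent_rows (hconcat P Q) J I"
  shows "dim {v. \<exists>u. \<forall>r\<in>J. row r P \<bullet> u + row r Q \<bullet> v = 0} + card I
         = CARD('b) + rank (row_submatrix I P)"
proof -
  let ?R = "(\<lambda>r. row r (hconcat P Q)) ` I"
  define W where "W = {z. \<forall>r\<in>I. row r (hconcat P Q) \<bullet> z = 0}"
  define p where "p = (\<lambda>z :: real ^ ('a + 'b). \<chi> b. z $ Inr b)"
  have W_span: "W = {z \<in> UNIV. \<forall>x \<in> span ?R. orthogonal x z}"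
  proof -
    have "span ?R \<subseteq> {x. orthogonal x z}" if "z \<in> W" for z
      using that by (intro span_minimal)
        (auto simp: W_def orthogonal_def subspace_def inner_add_left)
    then show ?thesis by (auto simp: W_def orthogonal_def span_base)
  qed
  have W: "subspace W"
    by (auto simp: W_def subspace_def inner_add_right)
  have p: "linear p"
    by (rule linearI) (auto simp: p_def vec_eq_iff)
  have "dim ?R = card I"
    using max by (simp add: maximal_independent_rows_def independent_rows_def
      dim_eq_card_independent card_image)
  moreover have "dim W + dim (span ?R) = DIM(real ^ ('a + 'b))"
    unfolding W_span using dim_subspace_orthogonal_to_vectors[of "span ?R" UNIV] by simp
  ultimately have dimW: "dim W + card I = CARD('a) + CARD('b)"
    by simp
  have "p ` W = {v. \<exists>u. \<forall>r\<in>J. row r P \<bullet> u + row r Q \<bullet> v = 0}"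
  proof -
    have I: "I \<subseteq> J" using max by (simp add: maximal_independent_rows_def)
    have "stack u v \<in> W \<longleftrightarrow> (\<forall>r\<in>J. row r P \<bullet> u + row r Q \<bullet> v = 0)" for u v
    proof
      assume "stack u v \<in> W"
      then show "\<forall>r\<in>J. row r P \<bullet> u + row r Q \<bullet> v = 0"
        using maximal_independent_rows_span[OF max] W_span
        by (auto simp: inner_row_hconcat_stack[symmetric] orthogonal_def)
    next
      assume "\<forall>r\<in>J. row r P \<bullet> u + row r Q \<bullet> v = 0"
      then show "stack u v \<in> W"
        using I by (auto simp: W_def inner_row_hconcat_stack)
    qed
    moreover have "p (stack u v) = v" for u v
      by (simp add: p_def stack_def vec_eq_iff)
    moreover have "p ` W = {p (stack u v) |u v. stack u v \<in> W}"
    proof safe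
      fix z assume "z \<in> W"
      then show "\<exists>u v. p z = p (stack u v) \<and> stack u v \<in> W"
        by (cases z rule: stack_exhaust) blast
    qed blast
    ultimately show ?thesis by auto
  qed
  moreover have "dim {z \<in> W. p z = 0} + rank (row_submatrix I P) = CARD('a)"
  proof -
    define N where "N = {u. row_submatrix I P *v u = 0}"
    have N: "u \<in> N \<longleftrightarrow> (\<forall>r\<in>I. row r P \<bullet> u = 0)" for u
      by (auto simp: N_def vec_eq_iff matrix_vector_mult_def row_submatrix_def row_def inner_vec_def)
    have eq: "{z \<in> W. p z = 0} = (\<lambda>u. stack u 0) ` N"
    proof -
      have "stack u v \<in> W \<and> p (stack u v) = 0 \<longleftrightarrow> u \<in> N \<and> v = 0" for u v
      proof -
        have "p (stack u v) = v" by (simp add: p_def stack_def vec_eq_iff)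
        then show ?thesis by (auto simp: W_def N inner_row_hconcat_stack)
      qed
      moreover have "{z \<in> W. p z = 0} = {stack u v |u v. stack u v \<in> W \<and> p (stack u v) = 0}"
      proof safe
        fix z assume "z \<in> W" "p z = 0"
        then show "\<exists>u v. z = stack u v \<and> stack u v \<in> W \<and> p (stack u v) = 0"
          by (cases z rule: stack_exhaust) blast
      qed
      ultimately show ?thesis by auto
    qed
    have "linear (\<lambda>u. stack u (0 :: real ^ 'b) :: real ^ ('a + 'b))"
      by (rule linearI) (auto simp: stack_def vec_eq_iff split: sum.split)
    moreover have "inj (\<lambda>u. stack u (0 :: real ^ 'b) :: real ^ ('a + 'b))"
    proof (rule injI)
      fix u v :: "real ^ 'a"
      assume eq: "stack u (0 :: real ^ 'b) = stack v 0"
      show "u = v" unfolding vec_eq_iff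
      proof
        fix i
        have "stack u (0 :: real ^ 'b) $ Inl i = stack v (0 :: real ^ 'b) $ Inl i"
          using eq by simp
        then show "u $ i = v $ i" by (simp add: stack_def)
      qed
    qed
    ultimately have "dim {z \<in> W. p z = 0} = dim N"
      unfolding eq by (intro dim_image_eq) (auto intro: inj_on_subset)
    moreover have "dim N + rank (row_submatrix I P) = CARD('a)"
      using dim_kernel_plus_dim_image[of "\<lambda>u. row_submatrix I P *v u" UNIV]
      by (simp add: N_def rank_dim_range)
    ultimately show ?thesis by simp
  qed
  ultimately show ?thesis
    using dim_kernel_plus_dim_image[OF p W] dimW by simp
qed

section \<open>Orthogonal projections\<close>

definition orthogonal_projection :: "'a::euclidean_space set \<Rightarrow> 'a \<Rightarrow> 'a" where
  "orthogonal_projection V y = (THE p. p \<in> V \<and> (\<forall>v\<in>V. orthogonal (y - p) v))"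

lemma orthogonal_projection_unique:
  assumes "subspace V" "p \<in> V" "\<And>v. v \<in> V \<Longrightarrow> orthogonal (y - p) v"
  shows "orthogonal_projection V y = p"
  unfolding orthogonal_projection_def
proof (rule the_equality)
  fix q assume q: "q \<in> V \<and> (\<forall>v\<in>V. orthogonal (y - q) v)"
  have "q - p \<in> V" using assms q by (simp add: subspace_diff)
  then have "orthogonal (y - p) (q - p)" "orthogonal (y - q) (q - p)"
    using assms q by auto
  then have "(q - p) \<bullet> (q - p) = 0" by (simp add: orthogonal_def algebra_simps)
  then show "q = p" by simp
qed (use assms in auto)

lemma orthogonal_projection_orthonormal_basis:
  assumes "subspace V" and B: "B \<subseteq> V" "pairwise orthogonal B" "\<And>b. b \<in> B \<Longrightarrow> norm b = 1"
    "finite B" "span B = V"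
  shows "orthogonal_projection V y = (\<Sum>b\<in>B. (y \<bullet> b) *\<^sub>R b)"
proof (rule orthogonal_projection_unique[OF assms(1)])
  show "(\<Sum>b\<in>B. (y \<bullet> b) *\<^sub>R b) \<in> V"
    using assms by (auto intro: subspace_sum subspace_scale)
  fix v assume "v \<in> V"
  have on_B: "orthogonal (y - (\<Sum>b\<in>B. (y \<bullet> b) *\<^sub>R b)) c" if c: "c \<in> B" for c
  proof -
    have "(\<Sum>b\<in>B. (y \<bullet> b) * (b \<bullet> c)) = (\<Sum>b\<in>B. if b = c then y \<bullet> c else 0)"
    proof (rule sum.cong)
      fix b assume "b \<in> B"
      then show "(y \<bullet> b) * (b \<bullet> c) = (if b = c then y \<bullet> c else 0)"
        using B(2,3) c by (auto simp: pairwise_def orthogonal_def norm_eq_1)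
    qed simp
    then show ?thesis
      using c B(4) by (simp add: orthogonal_def inner_diff_left inner_sum_left)
  qed
  have "span B \<subseteq> {c. orthogonal (y - (\<Sum>b\<in>B. (y \<bullet> b) *\<^sub>R b)) c}"
    by (intro span_minimal) (use on_B in \<open>auto simp: subspace_def orthogonal_def inner_add_right\<close>)
  then show "orthogonal (y - (\<Sum>b\<in>B. (y \<bullet> b) *\<^sub>R b)) v"
    using \<open>v \<in> V\<close> B(5) by blast
qed

lemma linear_orthogonal_projection:
  assumes "subspace V"
  shows "linear (orthogonal_projection V)"
proof -
  obtain B where B: "B \<subseteq> V" "pairwise orthogonal B" "\<And>b. b \<in> B \<Longrightarrow> norm b = 1"
      "independent B" "card B = dim V" "span B = V"
    using orthonormal_basis_subspace[OF assms] by blast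
  then have fin: "finite B" using independent_imp_finite by blast
  have P: "orthogonal_projection V y = (\<Sum>b\<in>B. (y \<bullet> b) *\<^sub>R b)" for y
    using orthogonal_projection_orthonormal_basis[of V B] assms B fin by blast
  show "linear (orthogonal_projection V)"
    by (rule linearI)
       (simp_all add: P inner_add_left scaleR_add_left sum.distrib scaleR_sum_right)
qed

text \<open>
  In an orthonormal basis \<open>B\<close> of \<open>V\<close> the diagonal entries are \<open>\<Sum>b\<in>B. (b $ i)\<^sup>2\<close>, and summing
  over \<open>i\<close> first gives \<open>norm b ^ 2 = 1\<close> for every \<open>b\<close>.
\<close>

lemma trace_orthogonal_projection:
  fixes V :: "(real ^ 'n::finite) set"
  assumes "subspace V"
  shows "(\<Sum>i\<in>UNIV. orthogonal_projection V (axis i 1) $ i) = real (dim V)"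
proof -
  obtain B where B: "B \<subseteq> V" "pairwise orthogonal B" "\<And>b. b \<in> B \<Longrightarrow> norm b = 1"
      "independent B" "card B = dim V" "span B = V"
    using orthonormal_basis_subspace[OF assms] by blast
  then have fin: "finite B" using independent_imp_finite by blast
  have P: "orthogonal_projection V y = (\<Sum>b\<in>B. (y \<bullet> b) *\<^sub>R b)" for y
    using orthogonal_projection_orthonormal_basis[of V B] assms B fin by blast
  have "(\<Sum>i\<in>UNIV. orthogonal_projection V (axis i 1) $ i) = (\<Sum>i\<in>UNIV. \<Sum>b\<in>B. b $ i * b $ i)"
    by (simp add: P inner_axis')
  also have "\<dots> = (\<Sum>b\<in>B. b \<bullet> b)"
    by (subst sum.swap) (simp add: inner_vec_def)
  also have "\<dots> = real (dim V)"
    using B(3,5) by (simp add: norm_eq_1)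
  finally show ?thesis .
qed

section \<open>The least squares estimate as a projection\<close>

lemma cls_solution_nearest:
  assumes "cls_solution x y \<theta> \<xi>"
  shows "cls_feasible x \<theta> \<xi>"
    and "cls_feasible x \<theta>' \<xi>' \<Longrightarrow> norm (\<theta> - y) \<le> norm (\<theta>' - y)"
proof -
  show "cls_feasible x \<theta> \<xi>"
    using assms by (simp add: cls_solution_def is_arg_min_def)
  assume "cls_feasible x \<theta>' \<xi>'"
  then have "\<not> (norm (\<theta>' - y))\<^sup>2 < (norm (\<theta> - y))\<^sup>2"
    using assms unfolding cls_solution_def is_arg_min_def by fastforce
  then show "norm (\<theta> - y) \<le> norm (\<theta>' - y)"
    by (meson not_le norm_ge_zero power_strict_mono zero_less_numeral)
qed

lemma cls_feasible_segment:
  assumes "cls_feasible x \<theta> \<xi>" "cls_feasible x \<theta>' \<xi>'" "0 \<le> u" "u \<le> 1"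
  shows "cls_feasible x ((1 - u) *\<^sub>R \<theta> + u *\<^sub>R \<theta>') ((1 - u) *\<^sub>R \<xi> + u *\<^sub>R \<xi>')"
  unfolding cls_feasible_def
proof (intro allI impI)
  fix j k :: 'a assume "j \<noteq> k"
  then have "(\<xi> $ j) \<bullet> (x k - x j) \<le> \<theta> $ k - \<theta> $ j" "(\<xi>' $ j) \<bullet> (x k - x j) \<le> \<theta>' $ k - \<theta>' $ j"
    using assms by (simp_all add: cls_feasible_def)
  then have "(1 - u) * ((\<xi> $ j) \<bullet> (x k - x j)) + u * ((\<xi>' $ j) \<bullet> (x k - x j))
      \<le> (1 - u) * (\<theta> $ k - \<theta> $ j) + u * (\<theta>' $ k - \<theta>' $ j)"
    using assms by (intro add_mono mult_left_mono) auto
  then show "((1 - u) *\<^sub>R \<xi> + u *\<^sub>R \<xi>') $ j \<bullet> (x k - x j)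
      \<le> ((1 - u) *\<^sub>R \<theta> + u *\<^sub>R \<theta>') $ k - ((1 - u) *\<^sub>R \<theta> + u *\<^sub>R \<theta>') $ j"
    by (simp add: inner_add_left algebra_simps)
qed

text \<open>
  It suffices to compare \<open>\<theta>\<close> with the points of the segment towards \<open>\<theta>'\<close>, which are feasible by
  convexity: \<open>\<theta>\<close> is the nearest point to \<open>y\<close> of this closed convex set.
\<close>

lemma cls_variational_inequality:
  assumes sol: "cls_solution x y \<theta> \<xi>" and feas: "cls_feasible x \<theta>' \<xi>'"
  shows "(y - \<theta>) \<bullet> (\<theta>' - \<theta>) \<le> 0"
proof (rule any_closest_point_dot)
  show "\<forall>z\<in>closed_segment \<theta> \<theta>'. dist y \<theta> \<le> dist y z"
  proof
    fix z assume "z \<in> closed_segment \<theta> \<theta>'"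
    then obtain u where u: "0 \<le> u" "u \<le> 1" and z: "z = (1 - u) *\<^sub>R \<theta> + u *\<^sub>R \<theta>'"
      by (auto simp: in_segment)
    show "dist y \<theta> \<le> dist y z"
      using cls_solution_nearest(2)[OF sol
          cls_feasible_segment[OF cls_solution_nearest(1)[OF sol] feas u]]
      by (simp add: z dist_norm norm_minus_commute)
  qed
qed auto

text \<open>
  The usual argument for nearest point maps: each of the two solutions serves as competitor in the
  variational inequality of the other.
\<close>

lemma cls_solution_nonexpansive:
  assumes 1: "cls_solution x y \<theta> \<xi>" and 2: "cls_solution x y' \<theta>' \<xi>'"
  shows "dist \<theta> \<theta>' \<le> dist y y'"
proof -
  have "(y - \<theta>) \<bullet> (\<theta>' - \<theta>) \<le> 0" "(y' - \<theta>') \<bullet> (\<theta> - \<theta>') \<le> 0"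
    using cls_variational_inequality[OF 1 cls_solution_nearest(1)[OF 2]]
      cls_variational_inequality[OF 2 cls_solution_nearest(1)[OF 1]] .
  then have "(\<theta> - \<theta>') \<bullet> (\<theta> - \<theta>') \<le> (y - y') \<bullet> (\<theta> - \<theta>')"
    by (simp add: algebra_simps inner_commute)
  also have "\<dots> \<le> norm (y - y') * norm (\<theta> - \<theta>')"
    by (rule norm_cauchy_schwarz)
  finally have "norm (\<theta> - \<theta>') * norm (\<theta> - \<theta>') \<le> norm (y - y') * norm (\<theta> - \<theta>')"
    by (simp add: power2_norm_eq_inner[symmetric] power2_eq_square)
  then show ?thesis
    by (cases "\<theta> = \<theta>'") (auto simp: dist_norm)
qed

text \<open>
  The linear span of the face on which the constraints in \<open>J\<close> are tight, projected to \<open>\<theta>\<close>, whenever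
  \<open>J\<close> is the active set of a feasible point.
\<close>

definition active_space ::
  "('n::finite \<Rightarrow> real ^ 'd::finite) \<Rightarrow> ('n \<times> 'n) set \<Rightarrow> (real ^ 'n) set" where
  "active_space x J =
     {\<theta>. \<exists>\<xi> :: (real ^ 'd) ^ 'n. \<forall>(j, k)\<in>J. (\<xi> $ j) \<bullet> (x k - x j) = \<theta> $ k - \<theta> $ j}"

lemma subspace_active_space: "subspace (active_space x J)"
  unfolding subspace_def
proof (intro conjI ballI allI)
  show "0 \<in> active_space x J"
    unfolding active_space_def by (auto intro!: exI[of _ 0])
next
  fix \<theta> \<theta>' assume "\<theta> \<in> active_space x J" "\<theta>' \<in> active_space x J"
  then obtain \<xi> \<xi>' where "\<And>j k. (j, k) \<in> J \<Longrightarrow> (\<xi> $ j) \<bullet> (x k - x j) = \<theta> $ k - \<theta> $ j"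
    "\<And>j k. (j, k) \<in> J \<Longrightarrow> (\<xi>' $ j) \<bullet> (x k - x j) = \<theta>' $ k - \<theta>' $ j"
    unfolding active_space_def by blast
  then show "\<theta> + \<theta>' \<in> active_space x J"
    unfolding active_space_def by (auto intro!: exI[of _ "\<xi> + \<xi>'"] simp: inner_add_left)
next
  fix c \<theta> assume "\<theta> \<in> active_space x J"
  then obtain \<xi> where "\<forall>(j, k)\<in>J. (\<xi> $ j) \<bullet> (x k - x j) = \<theta> $ k - \<theta> $ j"
    unfolding active_space_def by blast
  then show "c *\<^sub>R \<theta> \<in> active_space x J"
    unfolding active_space_def
    by (auto intro!: exI[of _ "c *\<^sub>R \<xi>"] simp: right_diff_distrib[symmetric])
qed

text \<open>
  Moving along \<open>v\<close>, with \<open>\<xi>\<close> moved along the witness \<open>\<eta>\<close> of \<open>v\<close>, keeps active constraints tight; the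
  finitely many inactive ones keep their strict inequality for all small steps of either sign.
\<close>

lemma active_direction_feasible:
  assumes feas: "cls_feasible x \<theta> \<xi>" and v: "v \<in> active_space x (active_set x \<theta> \<xi>)"
  obtains s \<xi>' \<xi>'' where "s > 0" "cls_feasible x (\<theta> + s *\<^sub>R v) \<xi>'" "cls_feasible x (\<theta> - s *\<^sub>R v) \<xi>''"
proof -
  obtain \<eta> where \<eta>: "\<And>j k. (j, k) \<in> active_set x \<theta> \<xi> \<Longrightarrow> (\<eta> $ j) \<bullet> (x k - x j) = v $ k - v $ j"
    using v unfolding active_space_def by blast
  \<comment> \<open>The slack of constraint \<open>(j, k)\<close> at \<open>(\<theta> + s v, \<xi> + s \<eta>)\<close>, as an affine function of \<open>s\<close>.\<close>
  define slack where "slack j k s = (\<theta> $ k - \<theta> $ j - (\<xi> $ j) \<bullet> (x k - x j))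
      + s * (v $ k - v $ j - (\<eta> $ j) \<bullet> (x k - x j))" for j k s
  have "\<forall>\<^sub>F s in at 0. j \<noteq> k \<longrightarrow> 0 \<le> slack j k s" for j k
  proof (cases "(j, k) \<in> active_set x \<theta> \<xi>")
    case True
    then have "slack j k s = 0" for s
      using \<eta>[OF True] by (simp add: slack_def active_set_def)
    then show ?thesis by simp
  next
    case False
    then have pos: "j \<noteq> k \<Longrightarrow> 0 < slack j k 0"
      using feas by (force simp: slack_def active_set_def cls_feasible_def)
    have "isCont (slack j k) 0"
      unfolding slack_def[abs_def] by (intro continuous_intros)
    then have "(slack j k \<longlongrightarrow> slack j k 0) (at 0)" by (simp add: isCont_def)
    then have "j \<noteq> k \<Longrightarrow> \<forall>\<^sub>F s in at 0. 0 < slack j k s"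
      using order_tendstoD(1) pos by blast
    then show ?thesis by (cases "j = k") (auto elim: eventually_mono)
  qed
  then have "\<forall>\<^sub>F s in at 0. \<forall>j k. j \<noteq> k \<longrightarrow> 0 \<le> slack j k s"
    by (intro eventually_all_finite)
  then obtain d where d: "d > 0"
    and nonneg: "\<And>s j k. s \<noteq> 0 \<Longrightarrow> \<bar>s\<bar> < d \<Longrightarrow> j \<noteq> k \<Longrightarrow> 0 \<le> slack j k s"
    unfolding eventually_at by (auto simp: dist_real_def)
  then have "cls_feasible x (\<theta> + s *\<^sub>R v) (\<xi> + s *\<^sub>R \<eta>)" if "s \<noteq> 0" "\<bar>s\<bar> < d" for s
    using nonneg[OF that] by (simp add: cls_feasible_def slack_def inner_add_left algebra_simps)
  from this[of "d / 2"] this[of "- d / 2"] d show ?thesis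
    by (intro that[of "d / 2"]) auto
qed

text \<open>
  The variational inequality, applied to a feasible step along \<open>v\<close> and to its opposite, gives both
  signs of \<open>(y - \<theta>) \<bullet> v\<close>.
\<close>

lemma cls_solution_orthogonal_projection:
  assumes sol: "cls_solution x y \<theta> \<xi>"
  shows "orthogonal_projection (active_space x (active_set x \<theta> \<xi>)) y = \<theta>"
proof (rule orthogonal_projection_unique[OF subspace_active_space])
  show "\<theta> \<in> active_space x (active_set x \<theta> \<xi>)"
    unfolding active_space_def active_set_def by auto
  fix v assume "v \<in> active_space x (active_set x \<theta> \<xi>)"
  then obtain s \<xi>' \<xi>'' where s: "s > 0" and
    "cls_feasible x (\<theta> + s *\<^sub>R v) \<xi>'" "cls_feasible x (\<theta> - s *\<^sub>R v) \<xi>''"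
    using active_direction_feasible[OF cls_solution_nearest(1)[OF sol]] by metis
  then have "(y - \<theta>) \<bullet> (s *\<^sub>R v) \<le> 0" "(y - \<theta>) \<bullet> (- s *\<^sub>R v) \<le> 0"
    using cls_variational_inequality[OF sol] by fastforce+
  then show "orthogonal (y - \<theta>) v"
    using s by (simp add: orthogonal_def mult_le_0_iff zero_le_mult_iff)
qed

section \<open>Dimension of the active space\<close>

lemma matA_row_inner:
  "row (j, k) (matA x) \<bullet> u = (\<chi> l. u $ (j, l)) \<bullet> (x k - x j)"
proof -
  have "row (j, k) (matA x) \<bullet> u
    = (\<Sum>(j', l)\<in>UNIV \<times> UNIV. if j' = j then (x k - x j) $ l * u $ (j, l) else 0)"
    unfolding inner_vec_def UNIV_Times_UNIV by (intro sum.cong) (auto simp: row_def matA_def)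
  also have "\<dots> = (\<Sum>j'\<in>UNIV. if j' = j then (\<Sum>l\<in>UNIV. (x k - x j) $ l * u $ (j, l)) else 0)"
    unfolding sum.cartesian_product[symmetric] by (intro sum.cong) auto
  finally show ?thesis by (simp add: inner_vec_def mult.commute)
qed

lemma matB_row_inner:
  assumes "j \<noteq> k"
  shows "row (j, k) matB \<bullet> v = v $ j - v $ k"
proof -
  have "row (j, k) matB \<bullet> v = (\<Sum>c\<in>UNIV. (if c = j then v $ c else 0) - (if c = k then v $ c else 0))"
    unfolding inner_vec_def using assms by (intro sum.cong) (auto simp: row_def matB_def)
  then show ?thesis by (simp add: sum_subtractf)
qed

text \<open>
  Diagonal pairs must be excluded: the row \<open>(j, j)\<close> of \<open>matB\<close> has a single entry \<open>1\<close> rather than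
  \<open>1 - 1\<close>, whereas the equation of the pair \<open>(j, j)\<close> in \<open>active_space\<close> is trivial.
\<close>

lemma active_space_matrix:
  assumes "\<And>j. (j, j) \<notin> J"
  shows "active_space x J = {v. \<exists>u. \<forall>r\<in>J. row r (matA x) \<bullet> u + row r matB \<bullet> v = 0}"
proof -
  have row_eq: "row (j, k) (matA x) \<bullet> u + row (j, k) matB \<bullet> v = 0
      \<longleftrightarrow> (\<chi> l. u $ (j, l)) \<bullet> (x k - x j) = v $ k - v $ j" if "(j, k) \<in> J" for j k u v
  proof -
    have "j \<noteq> k" using that assms by blast
    then show ?thesis by (auto simp: matA_row_inner matB_row_inner)
  qed
  show ?thesis
  proof (intro equalityI subsetI)
    fix v assume "v \<in> active_space x J"
    then obtain \<xi> where "\<forall>(j, k)\<in>J. (\<xi> $ j) \<bullet> (x k - x j) = v $ k - v $ j"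
      unfolding active_space_def by blast
    then have "\<forall>r\<in>J. row r (matA x) \<bullet> (\<chi> c. \<xi> $ fst c $ snd c) + row r matB \<bullet> v = 0"
      using row_eq by auto
    then show "v \<in> {v. \<exists>u. \<forall>r\<in>J. row r (matA x) \<bullet> u + row r matB \<bullet> v = 0}" by blast
  next
    fix v assume "v \<in> {v. \<exists>u. \<forall>r\<in>J. row r (matA x) \<bullet> u + row r matB \<bullet> v = 0}"
    then obtain u where "\<forall>r\<in>J. row r (matA x) \<bullet> u + row r matB \<bullet> v = 0" by blast
    then have "\<forall>(j, k)\<in>J. ((\<chi> j l. u $ (j, l)) $ j) \<bullet> (x k - x j) = v $ k - v $ j"
      using row_eq by auto
    then show "v \<in> active_space x J" unfolding active_space_def by blast
  qed
qed

lemma dim_active_space: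
  fixes x :: "'n::finite \<Rightarrow> real ^ 'd::finite"
  assumes "maximal_independent_rows (hconcat (matA x) matB) (active_set x \<theta> \<xi>) I"
  shows "real (dim (active_space x (active_set x \<theta> \<xi>)))
    = real CARD('n) - real (card I) + real (rank (row_submatrix I (matA x)))"
proof -
  have diag: "(j, j) \<notin> active_set x \<theta> \<xi>" for j
    by (simp add: active_set_def)
  have "dim (active_space x (active_set x \<theta> \<xi>)) + card I
      = CARD('n) + rank (row_submatrix I (matA x))"
    unfolding active_space_matrix[OF diag] by (rule dim_projected_null_space[OF assms])
  then show ?thesis by linarith
qed

section \<open>Continuous selections of linear maps\<close>

text \<open>
  Where two different maps \<open>P i\<close> and \<open>P j\<close> agree is a proper subspace and hence a null set. At a
  point \<open>y\<close> outside all of these, \<open>f y\<close> differs from \<open>P i y\<close> for every \<open>P i\<close> other than \<open>P (c y)\<close>,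
  and by continuity it still does so nearby, which leaves only \<open>P (c y)\<close>.
\<close>

lemma AE_continuous_linear_selection:
  fixes f :: "'a::euclidean_space \<Rightarrow> 'a" and P :: "'i \<Rightarrow> 'a \<Rightarrow> 'a"
  assumes f: "continuous_on UNIV f" and fin: "finite S"
    and P: "\<And>i. i \<in> S \<Longrightarrow> linear (P i)"
    and inS: "\<And>y. c y \<in> S" and sel: "\<And>y. f y = P (c y) y"
  shows "AE y in lborel. \<forall>\<^sub>F z in nhds y. f z = P (c y) z"
proof -
  have linear_ae: "AE y in lborel. P i y = P j y \<longrightarrow> P i = P j" if "i \<in> S" "j \<in> S" for i j
  proof (cases "P i = P j")
    case False
    let ?Z = "{y. P i y = P j y}"
    have Z: "subspace ?Z"
      using P that by (auto simp: subspace_def linear_0 linear_add linear_scale)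
    have "?Z \<noteq> UNIV" using False by auto
    then have "dim ?Z < DIM('a)"
      using Z by (metis dim_eq_full dim_subset_UNIV le_neq_implies_less span_eq_iff)
    then have "negligible ?Z" by (rule negligible_lowdim)
    moreover have "?Z \<in> sets borel" using closed_subspace[OF Z] by (rule borel_closed)
    ultimately have "?Z \<in> null_sets lborel"
      by (simp add: negligible_iff_null_sets null_sets_completion_iff)
    then show ?thesis using False by (intro AE_I'[of ?Z]) auto
  qed simp
  have "AE y in lborel. \<forall>i\<in>S. \<forall>j\<in>S. P i y = P j y \<longrightarrow> P i = P j"
    using fin linear_ae by (simp add: AE_finite_all)
  then show ?thesis
  proof eventually_elim
    case (elim y)
    have "\<forall>\<^sub>F z in nhds y. P i \<noteq> P (c y) \<longrightarrow> f z \<noteq> P i z" if i: "i \<in> S" for i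
    proof (cases "P i = P (c y)")
      case False
      then have "f y \<noteq> P i y" using elim i inS sel by metis
      moreover have "continuous_on UNIV (P i)"
        using P[OF i] by (simp add: linear_continuous_on linear_linear)
      ultimately have "open {z. f z \<noteq> P i z}" "y \<in> {z. f z \<noteq> P i z}"
        using f by (auto intro: open_Collect_neq)
      then show ?thesis
        by (auto simp: eventually_nhds)
    qed simp
    then have "\<forall>\<^sub>F z in nhds y. \<forall>i\<in>S. P i \<noteq> P (c y) \<longrightarrow> f z \<noteq> P i z"
      using fin by (simp add: eventually_ball_finite_distrib)
    then show ?case
      by eventually_elim (metis inS sel)
  qed
qed

lemma divergence_of_local_linear:
  fixes f :: "real ^ 'n::finite \<Rightarrow> real ^ 'n"
  assumes P: "linear P" and eq: "\<forall>\<^sub>F z in nhds y. f z = P z"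
  shows "partial_diffs_exist f y" "divergence f y = (\<Sum>i\<in>UNIV. P (axis i 1) $ i)"
proof -
  have der: "((\<lambda>t. f (y + t *\<^sub>R axis i 1) $ i) has_real_derivative P (axis i 1) $ i) (at 0)" for i
  proof -
    have "((\<lambda>t. P y $ i + t * P (axis i 1) $ i) has_real_derivative P (axis i 1) $ i) (at 0)"
      by (auto intro!: derivative_eq_intros)
    moreover have "((\<lambda>t. y + t *\<^sub>R axis i 1) \<longlongrightarrow> y) (nhds (0 :: real))"
      by (auto intro!: tendsto_eq_intros filterlim_ident)
    from filterlim_iff[THEN iffD1, rule_format, OF this eq]
    have "\<forall>\<^sub>F t in nhds 0. f (y + t *\<^sub>R axis i 1) $ i = P y $ i + t * P (axis i 1) $ i"
      by eventually_elim (simp add: linear_add[OF P] linear_scale[OF P])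
    ultimately show ?thesis by (subst DERIV_cong_ev[OF refl _ refl])
  qed
  show "partial_diffs_exist f y"
    using der field_differentiable_def unfolding partial_diffs_exist_def by blast
  show "divergence f y = (\<Sum>i\<in>UNIV. P (axis i 1) $ i)"
    unfolding divergence_def by (intro sum.cong refl DERIV_imp_deriv der)
qed

section \<open>Translations of the Gaussian density\<close>

lemma integrable_exp_abs_normal_density:
  assumes "\<sigma> > 0"
  shows "integrable lborel (\<lambda>u. exp (c * \<bar>u\<bar>) * normal_density 0 \<sigma> u)"
proof (rule Bochner_Integration.integrable_bound)
  \<comment> \<open>Completing the square turns the exponential factor into a shift of the mean.\<close>
  have shift: "exp (a * u) * normal_density 0 \<sigma> u = exp (a\<^sup>2 * \<sigma>\<^sup>2 / 2) * normal_density (a * \<sigma>\<^sup>2) \<sigma> u"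
    for a u
  proof -
    have "a * u + - (u - 0)\<^sup>2 / (2 * \<sigma>\<^sup>2) = a\<^sup>2 * \<sigma>\<^sup>2 / 2 + - (u - a * \<sigma>\<^sup>2)\<^sup>2 / (2 * \<sigma>\<^sup>2)"
      using assms by (simp add: field_simps power2_eq_square)
    then show ?thesis
      by (simp add: normal_density_def exp_add[symmetric] add.commute)
  qed
  show "integrable lborel (\<lambda>u. exp (c * u) * normal_density 0 \<sigma> u + exp (- c * u) * normal_density 0 \<sigma> u)"
    unfolding shift using assms by (intro Bochner_Integration.integrable_add) auto
  show "AE u in lborel. norm (exp (c * \<bar>u\<bar>) * normal_density 0 \<sigma> u)
      \<le> norm (exp (c * u) * normal_density 0 \<sigma> u + exp (- c * u) * normal_density 0 \<sigma> u)"
  proof (intro AE_I2)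
    fix u
    have "0 \<le> exp (c * u) * normal_density 0 \<sigma> u" "0 \<le> exp (- c * u) * normal_density 0 \<sigma> u"
      by simp_all
    then show "norm (exp (c * \<bar>u\<bar>) * normal_density 0 \<sigma> u)
      \<le> norm (exp (c * u) * normal_density 0 \<sigma> u + exp (- c * u) * normal_density 0 \<sigma> u)"
      by (cases "u \<ge> 0") auto
  qed
qed simp

lemma iso_normal_density_nonneg [simp]: "0 \<le> iso_normal_density \<sigma> e"
  by (simp add: iso_normal_density_def prod_nonneg)

lemma borel_measurable_iso_normal_density [measurable]:
  "iso_normal_density \<sigma> \<in> borel_measurable borel"
  unfolding iso_normal_density_def[abs_def] by measurable

text \<open>
  The integrand is a product of one-dimensional integrable functions. It dominates everything that
  appears in the limits below.
\<close>

lemma integrable_exp_iso_normal_density: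
  fixes c :: real
  assumes "\<sigma> > 0"
  shows "integrable lborel (\<lambda>e :: real ^ 'n::finite. exp (c * (\<Sum>j\<in>UNIV. \<bar>e $ j\<bar>)) * iso_normal_density \<sigma> e)"
proof -
  define h where "h u = exp (c * \<bar>u\<bar>) * normal_density 0 \<sigma> u" for u
  have [measurable]: "h \<in> borel_measurable borel"
    unfolding h_def[abs_def] by measurable
  have h0: "0 \<le> h u" for u by (simp add: h_def)
  have h: "exp (c * (\<Sum>j\<in>UNIV. \<bar>e $ j\<bar>)) * iso_normal_density \<sigma> e = (\<Prod>b\<in>Basis. h (e \<bullet> b))"
    for e :: "real ^ 'n"
  proof -
    have "(\<Prod>b\<in>Basis. h (e \<bullet> b)) = (\<Prod>j\<in>UNIV. h (e $ j))"
    proof -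
      have B: "(Basis :: (real ^ 'n) set) = range (\<lambda>j. axis j 1)"
        by (auto simp: Basis_vec_def)
      have "inj (\<lambda>j :: 'n. axis j (1 :: real))"
        by (auto simp: inj_on_def axis_eq_axis)
      then show ?thesis unfolding B
        by (simp add: prod.reindex inner_axis)
    qed
    then show ?thesis
      by (simp add: h_def prod.distrib iso_normal_density_def sum_distrib_left exp_sum)
  qed
  have fin: "(\<integral>\<^sup>+ u. ennreal (h u) \<partial>lborel) < \<infinity>"
    using integrable_exp_abs_normal_density[OF assms, of c] h0
    by (simp add: integrable_iff_bounded h_def)
  have "(\<integral>\<^sup>+ e. ennreal (\<Prod>b\<in>Basis. h (e \<bullet> b)) \<partial>(lborel :: (real ^ 'n) measure))
      = (\<integral>\<^sup>+ e. (\<Prod>b\<in>Basis. ennreal (h (e \<bullet> b))) \<partial>(lborel :: (real ^ 'n) measure))"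
    by (simp add: prod_ennreal h0)
  also have "\<dots> = (\<Prod>b\<in>(Basis :: (real ^ 'n) set). \<integral>\<^sup>+ u. ennreal (h u) \<partial>lborel)"
    by (rule nn_integral_lborel_prod) auto
  also have "\<dots> < \<infinity>"
    using fin by (simp add: power_less_top_ennreal)
  finally show ?thesis
    unfolding h using h0 by (intro integrableI_nonneg) (auto simp: prod_nonneg)
qed

lemma
  fixes f :: "'a::euclidean_space \<Rightarrow> real"
  assumes [measurable]: "f \<in> borel_measurable borel"
  shows lborel_integral_translation: "(\<integral>x. f (x + a) \<partial>lborel) = (\<integral>x. f x \<partial>lborel)"
    and lborel_integrable_translation: "integrable lborel (\<lambda>x. f (x + a)) \<longleftrightarrow> integrable lborel f"
proof -
  have "(\<integral>x. f x \<partial>lborel) = (\<integral>x. f x \<partial>distr lborel borel ((+) a))"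
    by (simp add: lborel_distr_plus)
  then show "(\<integral>x. f (x + a) \<partial>lborel) = (\<integral>x. f x \<partial>lborel)"
    by (simp add: integral_distr add.commute)
  have "integrable lborel f \<longleftrightarrow> integrable (distr lborel borel ((+) a)) f"
    by (simp add: lborel_distr_plus)
  then show "integrable lborel (\<lambda>x. f (x + a)) \<longleftrightarrow> integrable lborel f"
    by (simp add: integrable_distr_eq add.commute)
qed

lemma iso_normal_density_translate:
  assumes "\<sigma> > 0"
  shows "iso_normal_density \<sigma> (e - t *\<^sub>R axis i 1)
         = iso_normal_density \<sigma> e * exp ((2 * t * e $ i - t\<^sup>2) / (2 * \<sigma>\<^sup>2))"
proof -
  have 1: "normal_density 0 \<sigma> (u - t) = normal_density 0 \<sigma> u * exp ((2 * t * u - t\<^sup>2) / (2 * \<sigma>\<^sup>2))" for u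
  proof -
    have "- (u - t - 0)\<^sup>2 / (2 * \<sigma>\<^sup>2) = - (u - 0)\<^sup>2 / (2 * \<sigma>\<^sup>2) + (2 * t * u - t\<^sup>2) / (2 * \<sigma>\<^sup>2)"
      using assms by (simp add: field_simps power2_eq_square)
    then show ?thesis by (simp add: normal_density_def exp_add[symmetric])
  qed
  have "iso_normal_density \<sigma> (e - t *\<^sub>R axis i 1) =
    (\<Prod>j\<in>UNIV. normal_density 0 \<sigma> (e $ j) * (if j = i then exp ((2 * t * e $ i - t\<^sup>2) / (2 * \<sigma>\<^sup>2)) else 1))"
    unfolding iso_normal_density_def by (rule prod.cong) (auto simp: axis_def 1)
  then show ?thesis
    by (simp add: prod.distrib iso_normal_density_def)
qed

text \<open>
  A bound for difference quotients of the translated Gaussian density that is uniform in the step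
  \<open>t\<close>; it rests on \<open>\<bar>exp s - 1\<bar> \<le> \<bar>s\<bar> exp \<bar>s\<bar>\<close> and \<open>q \<le> exp q\<close>.
\<close>

lemma exp_minus_one_quotient_bound:
  fixes t q s :: real
  assumes "\<bar>s\<bar> \<le> \<bar>t\<bar> * q" "\<bar>t\<bar> \<le> 1" "t \<noteq> 0"
  shows "\<bar>(exp s - 1) / t\<bar> \<le> exp (2 * q)"
proof -
  have q: "0 \<le> q" using assms by (smt (verit) mult_pos_neg)
  have sq: "\<bar>s\<bar> \<le> q" using assms q mult_right_mono[of "\<bar>t\<bar>" 1 q] by linarith
  have "\<bar>exp s - 1\<bar> \<le> \<bar>s\<bar> * exp \<bar>s\<bar>"
  proof (cases "s \<ge> 0")
    case True
    have "1 - s \<le> exp (- s)" using exp_ge_add_one_self[of "- s"] by simp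
    then have "(1 - s) * exp s \<le> exp (- s) * exp s" by (intro mult_right_mono) auto
    then show ?thesis using True by (simp add: exp_minus algebra_simps)
  next
    case False
    have "1 + s \<le> exp s" by (rule exp_ge_add_one_self)
    moreover have "- s * 1 \<le> - s * exp (- s)" using False by (intro mult_left_mono) auto
    moreover have "\<bar>exp s - 1\<bar> = 1 - exp s" and s: "\<bar>s\<bar> = - s" using False by simp_all
    ultimately show ?thesis unfolding s by linarith
  qed
  also have "\<dots> \<le> (\<bar>t\<bar> * q) * exp q"
    using assms(1) sq q by (intro mult_mono) auto
  finally have "\<bar>(exp s - 1) / t\<bar> \<le> q * exp q"
    using assms(3) by (simp add: abs_divide divide_le_eq mult_ac)
  also have "\<dots> \<le> exp q * exp q"
    using exp_ge_add_one_self[of q] by (intro mult_right_mono exp_ge_zero) linarith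
  finally show ?thesis by (simp add: mult_exp_exp)
qed

text \<open>
  Translation invariance moves the shift by \<open>t\<close> from \<open>g\<close> onto the density, which is smooth: there it
  appears as the factor \<open>exp ((2 t e\<^sub>i - t\<^sup>2) / (2 \<sigma>\<^sup>2))\<close>, whose derivative at \<open>t = 0\<close> is \<open>e\<^sub>i / \<sigma>\<^sup>2\<close>.
  So \<open>g\<close> itself is never differentiated.
\<close>

lemma gaussian_difference_quotient_limit:
  fixes g :: "real ^ 'n::finite \<Rightarrow> real" and t :: "nat \<Rightarrow> real"
  assumes \<sigma>: "\<sigma> > 0" and [measurable]: "g \<in> borel_measurable borel"
    and growth: "\<And>e. \<bar>g e\<bar> \<le> C * exp (\<Sum>j\<in>UNIV. \<bar>e $ j\<bar>)"
    and t: "filterlim t (at 0) sequentially" "\<And>m. t m \<noteq> 0" "\<And>m. \<bar>t m\<bar> \<le> 1"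
  shows "integrable lborel (\<lambda>e. iso_normal_density \<sigma> e * (g e * e $ i))" (is ?int)
    and "(\<lambda>m. \<integral>e. iso_normal_density \<sigma> e * ((g (e + t m *\<^sub>R axis i 1) - g e) / t m) \<partial>lborel)
      \<longlonglongrightarrow> (\<integral>e. iso_normal_density \<sigma> e * (g e * e $ i) \<partial>lborel) / \<sigma>\<^sup>2" (is ?lim)
proof -
  let ?G = "iso_normal_density \<sigma> :: real ^ 'n \<Rightarrow> real"
  define S where "S = (\<lambda>e :: real ^ 'n. \<Sum>j\<in>UNIV. \<bar>e $ j\<bar>)"
  have [measurable]: "S \<in> borel_measurable borel" unfolding S_def by measurable
  have Si: "\<bar>e $ i\<bar> \<le> S e" for e
    unfolding S_def by (rule member_le_sum) auto
  have S0: "0 \<le> S e" for e unfolding S_def by (rule sum_nonneg) auto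
  have C: "0 \<le> C"
    using growth[of 0] by simp
  \<comment> \<open>The dominating function: the growth bound of \<open>g\<close> times the uniform bound on the quotients of \<open>E\<close>.\<close>
  define w where "w e = C * (exp (2 / \<sigma>\<^sup>2) * (exp ((1 + 2 / \<sigma>\<^sup>2) * S e) * ?G e))" for e
  have w: "integrable lborel w"
    unfolding w_def S_def
    by (intro integrable_mult_right integrable_exp_iso_normal_density \<sigma>)
  \<comment> \<open>The density at \<open>e - s axis i 1\<close> relative to the density at \<open>e\<close>.\<close>
  define E where "E s e = exp ((2 * s * e $ i - s\<^sup>2) / (2 * \<sigma>\<^sup>2))" for s and e :: "real ^ 'n"
  have [measurable]: "E s \<in> borel_measurable borel" for s
    unfolding E_def[abs_def] by measurable
  have E_bound: "\<bar>(E s e - 1) / s\<bar> \<le> exp (2 / \<sigma>\<^sup>2) * exp (2 / \<sigma>\<^sup>2 * S e)"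
    if s: "s \<noteq> 0" "\<bar>s\<bar> \<le> 1" for s e
  proof -
    have "\<bar>2 * s * e $ i - s\<^sup>2\<bar> \<le> \<bar>2 * s * e $ i\<bar> + \<bar>s\<^sup>2\<bar>" by (rule abs_triangle_ineq4)
    also have "\<dots> = \<bar>s\<bar> * (2 * \<bar>e $ i\<bar> + \<bar>s\<bar>)"
      by (simp add: abs_mult power2_eq_square algebra_simps)
    also have "\<dots> \<le> \<bar>s\<bar> * (2 * (1 + S e))"
      using s Si[of e] by (intro mult_left_mono) auto
    finally have "\<bar>(2 * s * e $ i - s\<^sup>2) / (2 * \<sigma>\<^sup>2)\<bar> \<le> \<bar>s\<bar> * ((1 + S e) / \<sigma>\<^sup>2)"
      using \<sigma> by (simp add: abs_divide divide_simps algebra_simps)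
    from exp_minus_one_quotient_bound[OF this s(2,1)]
    show ?thesis by (simp add: E_def exp_add[symmetric] add_divide_distrib)
  qed
  have dom: "norm (?G e * (g e * ((E s e - 1) / s))) \<le> w e"
    if s: "s \<noteq> 0" "\<bar>s\<bar> \<le> 1" for s e
  proof -
    have "norm (?G e * (g e * ((E s e - 1) / s))) = ?G e * (\<bar>g e\<bar> * \<bar>(E s e - 1) / s\<bar>)"
      by (simp add: abs_mult)
    also have "\<dots> \<le> ?G e * ((C * exp (S e)) * (exp (2 / \<sigma>\<^sup>2) * exp (2 / \<sigma>\<^sup>2 * S e)))"
      using growth[of e] E_bound[OF s, of e] C
      by (intro mult_left_mono mult_mono) (auto simp: S_def)
    also have "\<dots> = w e"
      by (simp add: w_def exp_add algebra_simps)
    finally show ?thesis .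
  qed
  have gG: "integrable lborel (\<lambda>e. ?G e * g e)"
  proof (rule Bochner_Integration.integrable_bound)
    show "integrable lborel (\<lambda>e. C * (exp (1 * S e) * ?G e))"
      unfolding S_def by (intro integrable_mult_right integrable_exp_iso_normal_density \<sigma>)
    show "AE e in lborel. norm (?G e * g e) \<le> norm (C * (exp (1 * S e) * ?G e))"
    proof (intro AE_I2)
      fix e
      have "?G e * \<bar>g e\<bar> \<le> ?G e * (C * exp (S e))"
        using growth[of e] by (intro mult_left_mono) (auto simp: S_def)
      then show "norm (?G e * g e) \<le> norm (C * (exp (1 * S e) * ?G e))"
        using C by (simp add: abs_mult mult_ac)
    qed
  qed measurable
  have quot_int: "integrable lborel (\<lambda>e. ?G e * (g e * ((E s e - 1) / s)))"
    if s: "s \<noteq> 0" "\<bar>s\<bar> \<le> 1" for s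
  proof (rule Bochner_Integration.integrable_bound[OF w])
    show "AE e in lborel. norm (?G e * (g e * ((E s e - 1) / s))) \<le> norm (w e)"
      using dom[OF s] by (intro AE_I2) (simp only: real_norm_def order_trans[OF _ abs_ge_self])
  qed measurable
  have move: "(\<integral>e. ?G e * ((g (e + s *\<^sub>R axis i 1) - g e) / s) \<partial>lborel)
      = (\<integral>e. ?G e * (g e * ((E s e - 1) / s)) \<partial>lborel)" if s: "s \<noteq> 0" "\<bar>s\<bar> \<le> 1" for s
  proof -
    let ?H = "\<lambda>e. ?G (e - s *\<^sub>R axis i 1) * g e"
    have H: "?H e = s * (?G e * (g e * ((E s e - 1) / s))) + ?G e * g e" for e
      using s by (simp add: iso_normal_density_translate[OF \<sigma>] E_def field_simps)
    have H_int: "integrable lborel ?H"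
      unfolding H by (intro Bochner_Integration.integrable_add integrable_mult_right quot_int[OF s] gG)
    have "integrable lborel (\<lambda>e. ?H (e + s *\<^sub>R axis i 1))"
      by (subst lborel_integrable_translation) (use H_int in auto)
    then have H'_int: "integrable lborel (\<lambda>e. ?G e * g (e + s *\<^sub>R axis i 1))"
      by simp
    have H_eq: "(\<integral>e. ?G e * g (e + s *\<^sub>R axis i 1) \<partial>lborel) = (\<integral>e. ?H e \<partial>lborel)"
      using lborel_integral_translation[of ?H "s *\<^sub>R axis i 1"] by simp
    have "(\<integral>e. ?G e * ((g (e + s *\<^sub>R axis i 1) - g e) / s) \<partial>lborel)
        = (\<integral>e. (?G e * g (e + s *\<^sub>R axis i 1) - ?G e * g e) / s \<partial>lborel)"
      by (simp add: algebra_simps)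
    also have "\<dots> = ((\<integral>e. ?H e \<partial>lborel) - (\<integral>e. ?G e * g e \<partial>lborel)) / s"
      using H'_int gG H_eq by simp
    also have "\<dots> = (\<integral>e. (?H e - ?G e * g e) / s \<partial>lborel)"
      using H_int gG by simp
    also have "\<dots> = (\<integral>e. ?G e * (g e * ((E s e - 1) / s)) \<partial>lborel)"
      unfolding H using s by simp
    finally show ?thesis .
  qed
  have lim: "(\<lambda>m. ?G e * (g e * ((E (t m) e - 1) / t m))) \<longlonglongrightarrow> ?G e * (g e * (e $ i / \<sigma>\<^sup>2))" for e
  proof -
    have "((\<lambda>s. E s e) has_real_derivative e $ i / \<sigma>\<^sup>2) (at 0)"
      unfolding E_def using \<sigma> by (auto intro!: derivative_eq_intros simp: field_simps)
    then have "((\<lambda>s. (E s e - 1) / s) \<longlongrightarrow> e $ i / \<sigma>\<^sup>2) (at 0)"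
      by (simp add: has_field_derivative_iff E_def)
    from filterlim_compose[OF this t(1)]
    show ?thesis by (intro tendsto_mult tendsto_const)
  qed
  have "integrable lborel (\<lambda>e. ?G e * (g e * (e $ i / \<sigma>\<^sup>2)))"
    by (rule integrable_dominated_convergence[OF _ _ w, where s = "\<lambda>m e. ?G e * (g e * ((E (t m) e - 1) / t m))"])
       (use lim dom t in auto)
  then have "integrable lborel (\<lambda>e. \<sigma>\<^sup>2 * (?G e * (g e * (e $ i / \<sigma>\<^sup>2))))"
    by (rule integrable_mult_right)
  then show ?int
    using \<sigma> by simp
  have "(\<lambda>m. \<integral>e. ?G e * (g e * ((E (t m) e - 1) / t m)) \<partial>lborel)
      \<longlonglongrightarrow> (\<integral>e. ?G e * (g e * (e $ i / \<sigma>\<^sup>2)) \<partial>lborel)"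
    by (rule integral_dominated_convergence[OF _ _ w])
       (use lim dom t in auto)
  then show ?lim
    using move t by simp
qed

section \<open>Stein's identity for Lipschitz maps\<close>

lemma AE_lborel_translation:
  fixes P :: "'a::euclidean_space \<Rightarrow> bool"
  assumes "AE y in lborel. P y"
  shows "AE e in lborel. P (a + e)"
proof (rule AE_distrD[of "(+) a" lborel borel P])
  show "AE y in distr lborel borel ((+) a). P y"
    using assms by (simp only: lborel_distr_plus)
qed simp

lemma distributed_AE_lborel:
  assumes X: "distributed M lborel X f" and "AE x in lborel. P x"
  shows "AE \<omega> in M. P (X \<omega>)"
proof (rule AE_distrD[of X M lborel])
  show "X \<in> measurable M lborel"
    using X by (simp add: distributed_def)
  have f: "f \<in> borel_measurable lborel" and eq: "distr M lborel X = density lborel f"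
    using X by (simp_all add: distributed_def)
  show "AE x in distr M lborel X. P x"
    unfolding eq AE_density[OF f] using assms(2) by eventually_elim simp
qed

text \<open>
  Brings the linear growth of a Lipschitz map into the product form that the Gaussian integrals use.
\<close>

lemma norm_le_exp_sum_abs:
  fixes e :: "real ^ 'n::finite"
  assumes "0 \<le> a" "0 \<le> b"
  shows "a + b * norm e \<le> (a + b) * exp (\<Sum>j\<in>UNIV. \<bar>e $ j\<bar>)"
proof -
  let ?S = "\<Sum>j\<in>UNIV. \<bar>e $ j\<bar>"
  have "0 \<le> ?S" by (rule sum_nonneg) simp
  then have "1 \<le> exp ?S" "norm e \<le> exp ?S"
    using norm_le_l1_cart[of e] exp_ge_add_one_self[of ?S] by linarith+
  then have "a * 1 + b * norm e \<le> a * exp ?S + b * exp ?S"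
    using assms by (intro add_mono mult_left_mono)
  then show ?thesis by (simp add: algebra_simps)
qed

lemma inverse_Suc_at_0: "filterlim (\<lambda>m. 1 / real (Suc m)) (at 0) sequentially"
  unfolding filterlim_at using LIMSEQ_inverse_real_of_nat by (simp add: inverse_eq_divide)

lemma tendsto_sequence_derivative:
  assumes "(\<phi> has_real_derivative D) (at 0)"
  shows "(\<lambda>m. (\<phi> (1 / real (Suc m)) - \<phi> 0) / (1 / real (Suc m))) \<longlonglongrightarrow> D"
proof -
  have "((\<lambda>s. (\<phi> s - \<phi> 0) / s) \<longlongrightarrow> D) (at 0)"
    using assms by (simp add: has_field_derivative_iff)
  from filterlim_compose[OF this inverse_Suc_at_0] show ?thesis .
qed

lemma borel_measurable_lipschitz_component:
  fixes f :: "real ^ 'n::finite \<Rightarrow> real ^ 'n"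
  assumes f: "L-lipschitz_on UNIV f"
  shows "(\<lambda>e. f (a + e) $ i) \<in> borel_measurable borel"
    and "(\<lambda>e. f (a + e + b) $ i) \<in> borel_measurable borel"
  by (intro borel_measurable_continuous_onI continuous_on_component continuous_intros
      continuous_on_compose2[OF lipschitz_on_continuous_on[OF f]]; simp)+

text \<open>
  \<open>gaussian_difference_quotient_limit\<close> is applied twice: to \<open>g = 1\<close>, where all quotients vanish and the noise turns
  out to be centred, and to the component of \<open>f\<close> reduced by its mean, whose quotients are those of
  \<open>f\<close> itself and for which the limit integral is the covariance.
\<close>

lemma (in prob_space) covariance_limit:
  fixes f :: "real ^ 'n::finite \<Rightarrow> real ^ 'n"
  assumes \<sigma>: "\<sigma> > 0" and \<epsilon>: "distributed M lborel \<epsilon> (\<lambda>e. ennreal (iso_normal_density \<sigma> e))"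
    and f: "L-lipschitz_on UNIV f"
  shows "(\<lambda>m. \<integral>\<omega>. (f (a + \<epsilon> \<omega> + (1 / real (Suc m)) *\<^sub>R axis i 1) $ i - f (a + \<epsilon> \<omega>) $ i)
        / (1 / real (Suc m)) \<partial>M)
      \<longlonglongrightarrow> covariance M (\<lambda>\<omega>. f (a + \<epsilon> \<omega>) $ i) (\<lambda>\<omega>. (a + \<epsilon> \<omega>) $ i) / \<sigma>\<^sup>2"
proof -
  have transfer: "(\<integral>\<omega>. h (\<epsilon> \<omega>) \<partial>M) = (\<integral>e. iso_normal_density \<sigma> e * h e \<partial>lborel)"
    if "h \<in> borel_measurable borel" for h
    using distributed_integral[OF \<epsilon>, of h] that by simp
  note [measurable] = borel_measurable_lipschitz_component[OF f]
  have L: "0 \<le> L" using f by (rule lipschitz_on_nonneg)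
  have "integrable lborel (\<lambda>e. iso_normal_density \<sigma> e * (1 * (e :: real ^ 'n) $ i))"
    and "(\<lambda>m. \<integral>e. iso_normal_density \<sigma> e * ((1 - 1) / (1 / real (Suc m))) \<partial>(lborel :: (real ^ 'n) measure))
      \<longlonglongrightarrow> (\<integral>e. iso_normal_density \<sigma> e * (1 * (e :: real ^ 'n) $ i) \<partial>lborel) / \<sigma>\<^sup>2"
    by (rule gaussian_difference_quotient_limit[where g = "\<lambda>_. 1" and C = 1, OF \<sigma> _ _ inverse_Suc_at_0];
        simp add: sum_nonneg)+
  then have \<epsilon>_int: "integrable lborel (\<lambda>e. iso_normal_density \<sigma> e * (e :: real ^ 'n) $ i)"
    and \<epsilon>_0: "(\<integral>e. iso_normal_density \<sigma> e * (e :: real ^ 'n) $ i \<partial>lborel) = 0"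
    using \<sigma> LIMSEQ_unique[OF tendsto_const] by fastforce+
  have "integrable M (\<lambda>\<omega>. \<epsilon> \<omega> $ i)"
    using \<epsilon>_int distributed_integrable[OF \<epsilon>, of "\<lambda>e. e $ i"] by simp
  then have mean: "(\<integral>\<omega>. (a + \<epsilon> \<omega>) $ i \<partial>M) = a $ i"
    using transfer[of "\<lambda>e. e $ i"] \<epsilon>_0 by (simp add: prob_space)
  define c where "c = (\<integral>\<omega>. f (a + \<epsilon> \<omega>) $ i \<partial>M)"
  define g where "g e = f (a + e) $ i - c" for e
  have [measurable]: "g \<in> borel_measurable borel" unfolding g_def[abs_def] by measurable
  have growth: "\<bar>g e\<bar> \<le> (\<bar>f a $ i - c\<bar> + L) * exp (\<Sum>j\<in>UNIV. \<bar>e $ j\<bar>)" for e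
  proof -
    have "\<bar>g e\<bar> \<le> \<bar>f a $ i - c\<bar> + \<bar>(f (a + e) - f a) $ i\<bar>" by (simp add: g_def)
    also have "\<bar>(f (a + e) - f a) $ i\<bar> \<le> norm (f (a + e) - f a)" by (rule component_le_norm_cart)
    also have "\<dots> \<le> L * norm e"
      using lipschitz_onD[OF f, of "a + e" a] by (simp add: dist_norm)
    finally have "\<bar>g e\<bar> \<le> \<bar>f a $ i - c\<bar> + L * norm e" by simp
    also have "\<dots> \<le> (\<bar>f a $ i - c\<bar> + L) * exp (\<Sum>j\<in>UNIV. \<bar>e $ j\<bar>)"
      using L by (intro norm_le_exp_sum_abs) auto
    finally show ?thesis .
  qed
  have "covariance M (\<lambda>\<omega>. f (a + \<epsilon> \<omega>) $ i) (\<lambda>\<omega>. (a + \<epsilon> \<omega>) $ i) = (\<integral>\<omega>. g (\<epsilon> \<omega>) * \<epsilon> \<omega> $ i \<partial>M)"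
    unfolding covariance_def mean by (simp add: g_def c_def)
  also have "\<dots> = (\<integral>e. iso_normal_density \<sigma> e * (g e * e $ i) \<partial>lborel)"
    by (rule transfer) measurable
  finally have cov: "covariance M (\<lambda>\<omega>. f (a + \<epsilon> \<omega>) $ i) (\<lambda>\<omega>. (a + \<epsilon> \<omega>) $ i)
    = (\<integral>e. iso_normal_density \<sigma> e * (g e * e $ i) \<partial>lborel)" .
  have "(\<integral>\<omega>. (f (a + \<epsilon> \<omega> + s *\<^sub>R axis i 1) $ i - f (a + \<epsilon> \<omega>) $ i) / s \<partial>M)
      = (\<integral>e. iso_normal_density \<sigma> e * ((g (e + s *\<^sub>R axis i 1) - g e) / s) \<partial>lborel)" for s
    by (subst transfer[symmetric]) (simp_all add: g_def add.assoc)
  then show ?thesis unfolding cov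
    by (simp only:) (rule gaussian_difference_quotient_limit[OF \<sigma> _ growth inverse_Suc_at_0]; simp)
qed

text \<open>
  The expected sum of the difference quotients of \<open>f\<close> converges to the left-hand side by
  \<open>covariance_limit\<close>, and to the expected divergence by dominated convergence, since the quotients
  are bounded by \<open>L\<close>. The divergence enters through a function \<open>D\<close> that agrees with it almost
  everywhere, because the value of the divergence on the exceptional set is arbitrary.
\<close>

theorem (in prob_space) stein_degrees_of_freedom:
  fixes f :: "real ^ 'n::finite \<Rightarrow> real ^ 'n"
  assumes \<sigma>: "\<sigma> > 0" and \<epsilon>: "distributed M lborel \<epsilon> (\<lambda>e. ennreal (iso_normal_density \<sigma> e))"
    and f: "L-lipschitz_on UNIV f"
    and D: "AE y in lborel. partial_diffs_exist f y \<and> divergence f y = D y"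
    and D_measurable: "(\<lambda>\<omega>. D (a + \<epsilon> \<omega>)) \<in> borel_measurable M"
  shows "degrees_of_freedom M \<sigma> f (\<lambda>\<omega>. a + \<epsilon> \<omega>) = (\<integral>\<omega>. D (a + \<epsilon> \<omega>) \<partial>M)"
proof -
  have [measurable]: "\<epsilon> \<in> borel_measurable M" using \<epsilon> by (simp add: distributed_def)
  note [measurable] = borel_measurable_lipschitz_component[OF f]
  define q where "q i m \<omega> = (f (a + \<epsilon> \<omega> + (1 / real (Suc m)) *\<^sub>R axis i 1) $ i - f (a + \<epsilon> \<omega>) $ i)
        / (1 / real (Suc m))" for i m \<omega>
  have [measurable]: "q i m \<in> borel_measurable M" for i m
  proof -
    have "(\<lambda>e. (f (a + e + (1 / real (Suc m)) *\<^sub>R axis i 1) $ i - f (a + e) $ i) / (1 / real (Suc m)))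
        \<in> borel_measurable borel"
      by measurable
    from measurable_compose[OF _ this, of \<epsilon> M] show ?thesis by (simp add: q_def[abs_def])
  qed
  have q_le: "\<bar>q i m \<omega>\<bar> \<le> L" for i m \<omega>
  proof -
    let ?s = "1 / real (Suc m)"
    have "\<bar>f (a + \<epsilon> \<omega> + ?s *\<^sub>R axis i 1) $ i - f (a + \<epsilon> \<omega>) $ i\<bar>
        \<le> norm (f (a + \<epsilon> \<omega> + ?s *\<^sub>R axis i 1) - f (a + \<epsilon> \<omega>))"
      using component_le_norm_cart by (metis vector_minus_component)
    also have "\<dots> \<le> L * ?s"
      using lipschitz_onD[OF f, of "a + \<epsilon> \<omega> + ?s *\<^sub>R axis i 1" "a + \<epsilon> \<omega>"] by (simp add: dist_norm)
    finally show ?thesis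
      by (simp add: q_def abs_mult divide_simps mult.commute)
  qed
  have q_int: "integrable M (q i m)" for i m
    by (rule integrable_const_bound[where B = L]) (use q_le in auto)
  have "(\<lambda>m. \<integral>\<omega>. (\<Sum>i\<in>UNIV. q i m \<omega>) \<partial>M) \<longlonglongrightarrow> (\<integral>\<omega>. D (a + \<epsilon> \<omega>) \<partial>M)"
  proof (rule integral_dominated_convergence)
    show "integrable M (\<lambda>_. \<Sum>i\<in>(UNIV :: 'n set). L)" by simp
    show "AE \<omega> in M. norm (\<Sum>i\<in>UNIV. q i m \<omega>) \<le> (\<Sum>i\<in>(UNIV :: 'n set). L)" for m
      using q_le by (intro AE_I2 sum_norm_le) simp
    have "AE \<omega> in M. partial_diffs_exist f (a + \<epsilon> \<omega>) \<and> divergence f (a + \<epsilon> \<omega>) = D (a + \<epsilon> \<omega>)"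
      by (rule distributed_AE_lborel[OF \<epsilon> AE_lborel_translation[OF D]])
    then show "AE \<omega> in M. (\<lambda>m. \<Sum>i\<in>UNIV. q i m \<omega>) \<longlonglongrightarrow> D (a + \<epsilon> \<omega>)"
    proof eventually_elim
      case (elim \<omega>)
      let ?d = "\<lambda>i. deriv (\<lambda>t. f (a + \<epsilon> \<omega> + t *\<^sub>R axis i 1) $ i) 0"
      have "(\<lambda>m. q i m \<omega>) \<longlonglongrightarrow> ?d i" for i
      proof -
        have "((\<lambda>t. f (a + \<epsilon> \<omega> + t *\<^sub>R axis i 1) $ i) has_real_derivative ?d i) (at 0)"
          using elim by (simp add: partial_diffs_exist_def DERIV_deriv_iff_field_differentiable)
        from tendsto_sequence_derivative[OF this] show ?thesis by (simp add: q_def)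
      qed
      then have "(\<lambda>m. \<Sum>i\<in>UNIV. q i m \<omega>) \<longlonglongrightarrow> (\<Sum>i\<in>UNIV. ?d i)"
        by (intro tendsto_sum)
      then show ?case using elim by (simp add: divergence_def)
    qed
  qed (use D_measurable in simp_all)
  moreover have "(\<lambda>m. \<integral>\<omega>. (\<Sum>i\<in>UNIV. q i m \<omega>) \<partial>M)
      \<longlonglongrightarrow> (\<Sum>i\<in>UNIV. covariance M (\<lambda>\<omega>. f (a + \<epsilon> \<omega>) $ i) (\<lambda>\<omega>. (a + \<epsilon> \<omega>) $ i) / \<sigma>\<^sup>2)"
  proof -
    have "(\<lambda>m. \<integral>\<omega>. q i m \<omega> \<partial>M)
        \<longlonglongrightarrow> covariance M (\<lambda>\<omega>. f (a + \<epsilon> \<omega>) $ i) (\<lambda>\<omega>. (a + \<epsilon> \<omega>) $ i) / \<sigma>\<^sup>2" for i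
      unfolding q_def by (rule covariance_limit[OF \<sigma> \<epsilon> f])
    then show ?thesis
      unfolding Bochner_Integration.integral_sum[OF q_int] by (rule tendsto_sum)
  qed
  ultimately have "(\<integral>\<omega>. D (a + \<epsilon> \<omega>) \<partial>M)
    = (\<Sum>i\<in>UNIV. covariance M (\<lambda>\<omega>. f (a + \<epsilon> \<omega>) $ i) (\<lambda>\<omega>. (a + \<epsilon> \<omega>) $ i) / \<sigma>\<^sup>2)"
    by (rule LIMSEQ_unique)
  then show ?thesis
    by (simp add: degrees_of_freedom_def sum_divide_distrib)
qed

section \<open>Divergence and degrees of freedom\<close>

theorem corollary4p3:
  fixes x :: "'n::finite \<Rightarrow> real ^ 'd::finite"
    and \<theta>h :: "real ^ 'n \<Rightarrow> real ^ 'n"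
    and \<xi>h :: "real ^ 'n \<Rightarrow> (real ^ 'd) ^ 'n"
    and I :: "real ^ 'n \<Rightarrow> ('n \<times> 'n) set"
  assumes "CARD('d) > 1"
    and "inj x"
    and "\<And>y. cls_solution x y (\<theta>h y) (\<xi>h y)"
    and "\<And>y. maximal_independent_rows (hconcat (matA x) matB)
               (active_set x (\<theta>h y) (\<xi>h y)) (I y)"
  shows
    "(AE y in lebesgue. partial_diffs_exist \<theta>h y \<and>
        divergence \<theta>h y =
          real CARD('n) - real (card (I y)) + real (rank (row_submatrix (I y) (matA x)))) \<and>
     (\<forall>(M :: 'w measure) \<epsilon> \<theta>s \<sigma>.
        prob_space M \<and> \<sigma> > 0 \<and>
        distributed M lborel \<epsilon> (\<lambda>e. ennreal (iso_normal_density \<sigma> e)) \<and>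
        (\<lambda>\<omega>. real (card (I (\<theta>s + \<epsilon> \<omega>)))) \<in> borel_measurable M \<and>
        (\<lambda>\<omega>. real (rank (row_submatrix (I (\<theta>s + \<epsilon> \<omega>)) (matA x)))) \<in> borel_measurable M
        \<longrightarrow>
        degrees_of_freedom M \<sigma> \<theta>h (\<lambda>\<omega>. \<theta>s + \<epsilon> \<omega>) =
          real CARD('n)
          - prob_space.expectation M (\<lambda>\<omega>. real (card (I (\<theta>s + \<epsilon> \<omega>))))
          + prob_space.expectation M
              (\<lambda>\<omega>. real (rank (row_submatrix (I (\<theta>s + \<epsilon> \<omega>)) (matA x)))))"
proof (intro conjI allI impI)
  let ?V = "\<lambda>y. active_space x (active_set x (\<theta>h y) (\<xi>h y))"
  let ?D = "\<lambda>y. real CARD('n) - real (card (I y)) + real (rank (row_submatrix (I y) (matA x)))"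
  have lipschitz: "1-lipschitz_on UNIV \<theta>h"
    by (rule lipschitz_onI) (simp_all add: cls_solution_nonexpansive[OF assms(3) assms(3)])
  have "AE y in lborel. \<forall>\<^sub>F z in nhds y. \<theta>h z = orthogonal_projection (?V y) z"
  proof (rule AE_continuous_linear_selection[where S = UNIV
        and P = "\<lambda>J. orthogonal_projection (active_space x J)" and c = "\<lambda>y. active_set x (\<theta>h y) (\<xi>h y)"])
    show "continuous_on UNIV \<theta>h"
      using lipschitz by (rule lipschitz_on_continuous_on)
    show "\<theta>h y = orthogonal_projection (?V y) y" for y
      by (rule cls_solution_orthogonal_projection[OF assms(3), symmetric])
  qed (simp_all add: linear_orthogonal_projection subspace_active_space)
  then have ae: "AE y in lborel. partial_diffs_exist \<theta>h y \<and> divergence \<theta>h y = ?D y"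
  proof eventually_elim
    case (elim y)
    have "linear (orthogonal_projection (?V y))"
      by (rule linear_orthogonal_projection[OF subspace_active_space])
    note local = divergence_of_local_linear[OF this elim]
    have "divergence \<theta>h y = real (dim (?V y))"
      unfolding local(2) by (rule trace_orthogonal_projection[OF subspace_active_space])
    also have "\<dots> = ?D y"
      by (rule dim_active_space[OF assms(4)])
    finally show ?case using local(1) by simp
  qed
  then show "AE y in lebesgue. partial_diffs_exist \<theta>h y \<and> divergence \<theta>h y = ?D y"
    by (rule AE_completion)
  fix M :: "'w measure" and \<epsilon> \<theta>s \<sigma>
  assume *: "prob_space M \<and> \<sigma> > 0 \<and>
        distributed M lborel \<epsilon> (\<lambda>e. ennreal (iso_normal_density \<sigma> e)) \<and>
        (\<lambda>\<omega>. real (card (I (\<theta>s + \<epsilon> \<omega>)))) \<in> borel_measurable M \<and>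
        (\<lambda>\<omega>. real (rank (row_submatrix (I (\<theta>s + \<epsilon> \<omega>)) (matA x)))) \<in> borel_measurable M"
  then interpret prob_space M by blast
  let ?c = "\<lambda>\<omega>. real (card (I (\<theta>s + \<epsilon> \<omega>)))"
  let ?r = "\<lambda>\<omega>. real (rank (row_submatrix (I (\<theta>s + \<epsilon> \<omega>)) (matA x)))"
  have [measurable]: "?c \<in> borel_measurable M" "?r \<in> borel_measurable M"
    using * by auto
  have "integrable M ?c"
    by (rule integrable_const_bound[where B = "real CARD('n \<times> 'n)"])
       (auto intro!: AE_I2 card_mono simp del: card_prod simp: of_nat_mult[symmetric] simp del: of_nat_mult)
  moreover have "integrable M ?r"
  proof (rule integrable_const_bound)
    show "AE \<omega> in M. norm (?r \<omega>) \<le> real CARD('n \<times> 'd)"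
      using rank_bound[where A = "row_submatrix (I _) (matA x)"]
      by (intro AE_I2) (simp del: card_prod)
  qed simp
  moreover have "degrees_of_freedom M \<sigma> \<theta>h (\<lambda>\<omega>. \<theta>s + \<epsilon> \<omega>) = (\<integral>\<omega>. ?D (\<theta>s + \<epsilon> \<omega>) \<partial>M)"
    by (rule stein_degrees_of_freedom[OF _ _ lipschitz ae]) (use * in auto)
  ultimately show "degrees_of_freedom M \<sigma> \<theta>h (\<lambda>\<omega>. \<theta>s + \<epsilon> \<omega>)
      = real CARD('n) - expectation ?c + expectation ?r"
    by (simp add: prob_space)
qed

end
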